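(* The star $K_{1,6}$ is not $123$-representable.
   Context: All graphs are simple. A word is a finite sequence of letters from a totally ordered alphabet. Two letters $x,y$ alternate in a word $w$ if between any two occurrences of $x$ there is an occurrence of $y$ and between any two occurrences of $y$ there is an occurrence of $x$. A graph $G=(V,E)$ is represented by a word $w$ over $V$ if for all distinct $x,y\in V$, $x$ and $y$ alternate in $w$ if and only if $xy\in E$. A word contains the pattern $123$ if it has a strictly increasing subsequence of length $3$, and avoids $123$ otherwise. A graph is $123$-representable if, after labeling its vertices by distinct elements of a totally ordered set (any labeling may be chosen), it is represented by a $123$-avoiding word. *)

theory Defs
  imports "Graph_Theory.Graph_Theory" "HOL-Library.Sublist"
begin

text \<open>
  Graphs are those of Graph_Theory: the locale \<^locale>\<open>graph\<close> describes finite symmetric digraphs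
  without loops and multiple arcs, and \<open>u \<rightarrow>\<^bsub>G\<^esub> v\<close> says that \<open>u\<close> and \<open>v\<close> are adjacent.
\<close>

definition separates :: "'a \<Rightarrow> 'a \<Rightarrow> 'a list \<Rightarrow> bool" where
  "separates y x w \<longleftrightarrow>
     (\<forall>i j. i < j \<and> j < length w \<and> w ! i = x \<and> w ! j = x \<longrightarrow>
        (\<exists>k. i < k \<and> k < j \<and> w ! k = y))"

definition alternate :: "'a \<Rightarrow> 'a \<Rightarrow> 'a list \<Rightarrow> bool" where
  "alternate x y w \<longleftrightarrow> separates y x w \<and> separates x y w"

text \<open>
  Vertices need not occur in a representing word. Some authors require \<open>set w = verts G\<close>, which
  makes fewer graphs representable, so non-representability in the sense used here implies
  non-representability in theirs.
\<close>

definition represents :: "'a list \<Rightarrow> ('a, 'b) pre_digraph \<Rightarrow> bool" where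
  "represents w G \<longleftrightarrow> set w \<subseteq> verts G \<and>
     (\<forall>x\<in>verts G. \<forall>y\<in>verts G. x \<noteq> y \<longrightarrow> (alternate x y w \<longleftrightarrow> x \<rightarrow>\<^bsub>G\<^esub> y))"

definition contains_123 :: "'l::linorder list \<Rightarrow> bool" where
  "contains_123 w \<longleftrightarrow> (\<exists>u. subseq u w \<and> length u = 3 \<and> sorted_wrt (<) u)"

text \<open>
  The labels are taken from the totally ordered type \<open>'l\<close>. HOL cannot quantify over types inside a
  formula, so \<open>'l\<close> is a parameter; a graph fails to be 123-representable if the predicate is false
  for every \<open>'l\<close>.
\<close>

definition representable_123 :: "'l::linorder itself \<Rightarrow> ('a, 'b) pre_digraph \<Rightarrow> bool" where
  "representable_123 _ G \<longleftrightarrow>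
     (\<exists>(label :: 'a \<Rightarrow> 'l) w. inj_on label (verts G) \<and> represents w G \<and>
        \<not> contains_123 (map label w))"

end

theory Submission
  imports Defs
begin

text \<open>
  Cut the word at the occurrences of the centre \<open>c\<close>: every leaf occurs exactly once in each inner
  block and at most once in the two outer ones. Two leaves that each occur at most once alternate,
  so at most one leaf is that rare. After the first \<open>c\<close>, leaves above \<open>c\<close> must appear in decreasing
  order, for otherwise \<open>c\<close> starts a 123; two such leaves that occur once before and once after this
  \<open>c\<close> do not alternate only if they increase before it, so there are at most two of them. Reversing
  both the word and the order gives the same bound below \<open>c\<close>. This leaves at most
  \<open>1 + 2 + 2 = 5\<close> leaves if \<open>c\<close> occurs once. If \<open>c\<close> occurs twice and there are leaves on both sides
  of \<open>c\<close>, then no leaf above \<open>c\<close> occurs in the last block (it would end a 123 whose first letter is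
  in the middle block), so the bound applies again; with three occurrences of \<open>c\<close> there is at most
  one leaf on each side.
\<close>

section \<open>Alternation of two letters\<close>

text \<open>Trades positions for factorizations, so that blocks obtained by cutting a word can be
  fed directly to alternation hypotheses.\<close>

lemma separates_iff_append:
  "separates y x w \<longleftrightarrow> (\<forall>A B C. w = A @ x # B @ x # C \<longrightarrow> y \<in> set B)"
proof (intro iffI allI impI)
  fix A B C
  assume sep: "separates y x w" and w: "w = A @ x # B @ x # C"
  have "\<exists>k>length A. k < length A + Suc (length B) \<and> w ! k = y"
    using sep unfolding separates_def by (auto simp: w nth_append)
  then obtain k where k: "length A < k" "k < length A + Suc (length B)" "w ! k = y" by blast
  then have "y = B ! (k - Suc (length A))" "k - Suc (length A) < length B"
    by (auto simp: w nth_append nth_Cons')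
  then show "y \<in> set B" by simp
next
  assume R: "\<forall>A B C. w = A @ x # B @ x # C \<longrightarrow> y \<in> set B"
  show "separates y x w"
    unfolding separates_def
  proof (intro allI impI)
    fix i j
    assume ij: "i < j \<and> j < length w \<and> w ! i = x \<and> w ! j = x"
    \<comment> \<open>The stretch strictly between positions \<open>i\<close> and \<open>j\<close>;
      its letter number \<open>m\<close> sits at position \<open>Suc i + m\<close> of
      \<open>w\<close>.\<close>
    define B where "B = take (j - Suc i) (drop (Suc i) w)"
    have "w = take i w @ x # drop (Suc i) w" using ij id_take_nth_drop[of i w] by auto
    also have "drop (Suc i) w = B @ x # drop (Suc j) w"
      using ij id_take_nth_drop[of "j - Suc i" "drop (Suc i) w"] by (auto simp: B_def)
    finally have "y \<in> set B" using R by blast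
    then obtain m where "m < length B" "B ! m = y" by (auto simp: in_set_conv_nth)
    then show "\<exists>k>i. k < j \<and> w ! k = y"
      using ij by (intro exI[of _ "Suc i + m"]) (auto simp: B_def)
  qed
qed

lemma not_distinct_adj_filter_split:
  assumes "\<not> distinct_adj (filter P w)"
  obtains A a B C where "w = A @ a # B @ a # C" "P a" "\<forall>z\<in>set B. \<not> P z"
  using assms
proof (induction w arbitrary: thesis)
  case (Cons b w)
  show ?case
  proof (cases "distinct_adj (filter P w)")
    case True
    \<comment> \<open>The tail is free of equal neighbours, so the clash involves \<open>b\<close>
      and the first surviving letter of \<open>w\<close>.\<close>
    with Cons.prems(2) have "P b" "filter P w = b # tl (filter P w)"
      by (cases "filter P w"; auto split: if_splits)+
    then obtain B C where "w = B @ b # C" "\<forall>z\<in>set B. \<not> P z"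
      by (metis filter_eq_ConsD)
    with \<open>P b\<close> show ?thesis using Cons.prems(1)[of "[]" b B C] by simp
  next
    case False
    then obtain A a B C where "w = A @ a # B @ a # C" "P a" "\<forall>z\<in>set B. \<not> P z"
      using Cons.IH by blast
    then show ?thesis using Cons.prems(1)[of "b # A" a B C] by simp
  qed
qed simp

lemma filter_pair_notin:
  "x \<notin> set w \<Longrightarrow> filter (\<lambda>z. z \<in> {x, y}) w = replicate (count_list w y) y"
  by (induction w) auto

lemma distinct_adj_filter_separates:
  assumes "distinct_adj (filter (\<lambda>z. z \<in> {x, y}) w)"
  shows "separates y x w"
  unfolding separates_iff_append
proof (intro allI impI, rule ccontr)
  fix A B C
  assume w: "w = A @ x # B @ x # C" and y: "y \<notin> set B"
  have "filter (\<lambda>z. z \<in> {x, y}) B = replicate (count_list B x) x"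
    using filter_pair_notin[OF y, of x] by (simp add: disj_commute)
  \<comment> \<open>Whether or not \<open>B\<close> contains \<open>x\<close>, the \<open>x\<close>
    in front of \<open>B\<close> is followed by another \<open>x\<close> in the restricted
    word.\<close>
  then show False
    using assms by (cases "count_list B x") (auto simp: w distinct_adj_append_iff)
qed

text \<open>Over two letters, alternating literally means having no equal neighbours. Reversal and
  relabelling become simple in this form, and short restricted words can be evaluated.\<close>

lemma alternate_iff_distinct_adj:
  "x \<noteq> y \<Longrightarrow> alternate x y w \<longleftrightarrow> distinct_adj (filter (\<lambda>z. z \<in> {x, y}) w)"
proof
  assume alt: "alternate x y w"
  show "distinct_adj (filter (\<lambda>z. z \<in> {x, y}) w)"
  proof (rule ccontr)
    assume "\<not> ?thesis"
    then obtain A a B C where w: "w = A @ a # B @ a # C" and a: "a \<in> {x, y}"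
      and B: "\<forall>z\<in>set B. z \<notin> {x, y}"
      using not_distinct_adj_filter_split by blast
    then have "(a = x \<longrightarrow> y \<in> set B) \<and> (a = y \<longrightarrow> x \<in> set B)"
      using alt unfolding alternate_def separates_iff_append by blast
    then show False using a B by auto
  qed
next
  assume "distinct_adj (filter (\<lambda>z. z \<in> {x, y}) w)"
  then show "alternate x y w"
    using distinct_adj_filter_separates[of x y w] distinct_adj_filter_separates[of y x w]
    by (simp add: alternate_def disj_commute)
qed

lemma alternate_rev: "x \<noteq> y \<Longrightarrow> alternate x y (rev w) \<longleftrightarrow> alternate x y w"
  by (simp add: alternate_iff_distinct_adj flip: rev_filter)

text \<open>Carries alternation from vertices to labels. Injectivity covers \<open>x\<close> and
  \<open>y\<close> explicitly because they may be absent from \<open>w\<close>.\<close>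

lemma alternate_map:
  assumes inj: "inj_on f (insert x (insert y (set w)))" and "x \<noteq> y"
  shows "alternate (f x) (f y) (map f w) \<longleftrightarrow> alternate x y w"
proof -
  have "filter (\<lambda>z. z \<in> {f x, f y}) (map f w) = map f (filter (\<lambda>z. z \<in> {x, y}) w)"
    using inj by (auto simp: filter_map inj_on_def intro!: arg_cong[of _ _ "map f"] filter_cong)
  moreover have "f x \<noteq> f y" using assms by (auto simp: inj_on_def)
  moreover have "inj_on f (set (filter (\<lambda>z. z \<in> {x, y}) w))"
    using inj by (rule inj_on_subset) auto
  ultimately show ?thesis
    using \<open>x \<noteq> y\<close> by (simp add: alternate_iff_distinct_adj distinct_adj_map_iff)
qed

section \<open>Rare letters and increasing triples\<close>

text \<open>Separation is vacuous for a letter without two occurrences.\<close>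

lemma alternate_if_rare:
  assumes "count_list w x \<le> 1" "count_list w y \<le> 1"
  shows "alternate x y w"
  using assms by (auto simp: alternate_def separates_iff_append)

lemma card_le_1_if_alternate:
  assumes "\<And>x y. x \<in> P \<Longrightarrow> y \<in> P \<Longrightarrow> x \<noteq> y \<Longrightarrow> \<not> alternate x y w"
    and "\<And>x. x \<in> P \<Longrightarrow> count_list w x \<le> 1"
  shows "card P \<le> 1"
proof (rule ccontr)
  assume "\<not> ?thesis"
  then have "Suc 0 < card P" by simp
  then obtain x y where "x \<in> P" "y \<in> P" "x \<noteq> y"
    by (metis card.infinite card_le_Suc0_iff_eq leD not_less0)
  then show False using assms alternate_if_rare by metis
qed

lemma subseq_rev: "subseq xs ys \<Longrightarrow> subseq (rev xs) (rev ys)"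
  by (induction rule: list_emb.induct) (auto intro: list_emb_append_mono subseq_rev_drop_many)

lemma filter_pair_once:
  assumes "count_list A x = 1" "count_list A y = 1" "x \<noteq> y"
  shows "filter (\<lambda>z. z \<in> {x, y}) A = [x, y] \<or> filter (\<lambda>z. z \<in> {x, y}) A = [y, x]"
proof -
  obtain P Q where A: "A = P @ x # Q" and "x \<notin> set P" "x \<notin> set Q"
    using count_list_Suc_split_first[of A x 0] assms by (auto simp: count_list_0_iff)
  then have f: "filter (\<lambda>z. z \<in> {x, y}) A =
      replicate (count_list P y) y @ x # replicate (count_list Q y) y"
    using filter_pair_notin[of x P y] filter_pair_notin[of x Q y] by simp
  have "count_list P y + count_list Q y = 1" using assms by (simp add: A)
  then consider "count_list P y = 0" "count_list Q y = 1"
    | "count_list P y = 1" "count_list Q y = 0" by linarith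
  then show ?thesis by cases (simp_all only: f, simp_all)
qed

lemma subseq_if_filter_pair: "filter (\<lambda>z. z \<in> {x, y}) A = [x, y] \<Longrightarrow> subseq [x, y] A"
  by (metis subseq_filter_left)

text \<open>Both restricted words use the same occurrence of \<open>y\<close>; cutting
  \<open>A\<close> there leaves \<open>x\<close> on its left and \<open>z\<close> on its
  right.\<close>

lemma subseq_triple_if_filter_pairs:
  assumes "count_list A y = 1"
    and xy: "filter (\<lambda>z. z \<in> {x, y}) A = [x, y]" and yz: "filter (\<lambda>t. t \<in> {y, z}) A = [y, z]"
    and "x \<noteq> y" "y \<noteq> z"
  shows "subseq [x, y, z] A"
proof -
  obtain P Q where A: "A = P @ y # Q" and "y \<notin> set P" "y \<notin> set Q"
    using count_list_Suc_split_first[of A y 0] assms by (auto simp: count_list_0_iff)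
  have "x \<in> set P"
  proof (rule ccontr)
    assume "x \<notin> set P"
    then have "filter (\<lambda>z. z \<in> {x, y}) P = []"
      using \<open>y \<notin> set P\<close> by (auto simp: filter_empty_conv)
    then show False using xy \<open>x \<noteq> y\<close> by (simp add: A)
  qed
  moreover have "z \<in> set Q"
  proof (rule ccontr)
    assume "z \<notin> set Q"
    then have "filter (\<lambda>t. t \<in> {y, z}) Q = []"
      using \<open>y \<notin> set Q\<close> by (auto simp: filter_empty_conv)
    \<comment> \<open>The restricted word would end in \<open>y\<close>, whereas
      \<open>[y, z]\<close> ends in \<open>z\<close>.\<close>
    then have "filter (\<lambda>t. t \<in> {y, z}) A = filter (\<lambda>t. t \<in> {y, z}) P @ [y]" by (simp add: A)
    then show False using yz \<open>y \<noteq> z\<close> by (simp add: append_eq_Cons_conv)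
  qed
  ultimately have "subseq ([x] @ [y] @ [z]) (P @ [y] @ Q)"
    by (intro list_emb_append_mono) (simp_all add: subseq_singleton_left)
  then show ?thesis by (simp add: A)
qed

lemma (in linorder) card_ge_3_obtain_less:
  assumes "3 \<le> card P"
  obtains x y z where "x \<in> P" "y \<in> P" "z \<in> P" "x < y" "y < z"
proof -
  have fin: "finite P" using assms by (metis card.infinite not_numeral_le_zero)
  obtain l where l: "sorted_list_of_set P = l" "set l = P" "length l = card P" "sorted_wrt (<) l"
    using fin strict_sorted_list_of_set by auto
  then have "l ! 0 < l ! 1" "l ! 1 < l ! 2" using assms by (auto simp: sorted_wrt_iff_nth_less)
  moreover have "l ! 0 \<in> P" "l ! 1 \<in> P" "l ! 2 \<in> P"
    using assms l nth_mem[of _ l] by auto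
  ultimately show ?thesis using that by blast
qed

text \<open>The letters of \<open>P\<close> decrease in \<open>E\<close>, hence increase in
  \<open>A\<close>, where three of them would form a 123. The tail \<open>E\<close> may contain
  further copies of \<open>c\<close>, as happens with two centres.\<close>

lemma (in linorder) card_le_2_if_above:
  assumes av: "\<And>x y z. x < y \<Longrightarrow> y < z \<Longrightarrow> \<not> subseq [x, y, z] w"
    and w: "w = A @ c # E"
    and nalt: "\<And>x y. x \<in> P \<Longrightarrow> y \<in> P \<Longrightarrow> x \<noteq> y \<Longrightarrow> \<not> alternate x y w"
    and gt: "\<And>x. x \<in> P \<Longrightarrow> c < x"
    and cA: "\<And>x. x \<in> P \<Longrightarrow> count_list A x = 1"
    and cE: "\<And>x. x \<in> P \<Longrightarrow> count_list E x = 1"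
  shows "card P \<le> 2"
proof (rule ccontr)
  assume "\<not> ?thesis"
  then obtain x y z where xyz: "x \<in> P" "y \<in> P" "z \<in> P" "x < y" "y < z"
    using card_ge_3_obtain_less[of P] by auto
  have incr: "filter (\<lambda>t. t \<in> {a, b}) A = [a, b]" if ab: "a \<in> P" "b \<in> P" "a < b" for a b
  proof -
    have "\<not> subseq [a, b] E"
    proof
      assume "subseq [a, b] E"
      then have "subseq [c, a, b] w" by (simp add: w subseq_drop_many)
      then show False using av gt ab by blast
    qed
    then have fE: "filter (\<lambda>t. t \<in> {a, b}) E = [b, a]"
      using filter_pair_once[of E a b] subseq_if_filter_pair[of a b E] cE ab by auto
    have "filter (\<lambda>t. t \<in> {a, b}) A \<noteq> [b, a]"
    proof
      assume fA: "filter (\<lambda>t. t \<in> {a, b}) A = [b, a]"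
      \<comment> \<open>The filter drops \<open>c\<close>, which lies strictly below
        \<open>a\<close> and \<open>b\<close>; the result has no equal neighbours.\<close>
      have "filter (\<lambda>t. t \<in> {a, b}) w = [b, a, b, a]"
        using fA fE gt ab unfolding w by auto
      then show False using nalt[of a b] ab by (auto simp: alternate_iff_distinct_adj)
    qed
    then show ?thesis using filter_pair_once[of A a b] cA ab by auto
  qed
  have "subseq [x, y, z] A"
    using incr xyz cA by (intro subseq_triple_if_filter_pairs) auto
  then have "subseq [x, y, z] w" by (simp add: w subseq_rev_drop_many)
  then show False using av xyz by blast
qed

section \<open>Words representing a star\<close>

text \<open>The order is a parameter, so that the reversed word with the dual order is again an
  instance and each bound above \<open>c\<close> yields one below \<open>c\<close>.\<close>

locale star_word = linorder less_eq less
  for less_eq :: "'a \<Rightarrow> 'a \<Rightarrow> bool" (infix "\<preceq>" 50)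
    and less :: "'a \<Rightarrow> 'a \<Rightarrow> bool" (infix "\<prec>" 50) +
  fixes w :: "'a list" and c :: 'a and S :: "'a set"
  assumes finite_leaves: "finite S"
    and center_not_leaf: "c \<notin> S"
    and avoids: "x \<prec> y \<Longrightarrow> y \<prec> z \<Longrightarrow> \<not> subseq [x, y, z] w"
    and alternate_center: "x \<in> S \<Longrightarrow> alternate c x w"
    and not_alternate_leaves: "x \<in> S \<Longrightarrow> y \<in> S \<Longrightarrow> x \<noteq> y \<Longrightarrow> \<not> alternate x y w"
begin

text \<open>Two copies of \<open>x\<close> in \<open>B\<close> would have to be separated by
  \<open>c\<close>.\<close>

lemma count_le_1:
  assumes "w = A @ B @ C" "c \<notin> set B" "x \<in> S"
  shows "count_list B x \<le> 1"
proof (rule ccontr)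
  assume "\<not> ?thesis"
  then obtain n where "count_list B x = Suc (Suc n)"
    by (metis One_nat_def le0 not0_implies_Suc not_less_eq_eq)
  then obtain P Q where "B = P @ x # Q" "count_list Q x = Suc n"
    using count_list_Suc_split_first by metis
  moreover then obtain U V where "Q = U @ x # V"
    using count_list_Suc_split_first by metis
  ultimately have "w = (A @ P) @ x # U @ x # (V @ C)" "c \<notin> set U"
    using assms by auto
  then show False
    using alternate_center[OF \<open>x \<in> S\<close>] unfolding alternate_def separates_iff_append by blast
qed

text \<open>Here the other half of alternation also acts: \<open>x\<close> separates the two copies
  of \<open>c\<close>.\<close>

lemma count_eq_1:
  assumes "w = A @ c # B @ c # C" "c \<notin> set B" "x \<in> S"
  shows "count_list B x = 1"
proof -
  have "x \<in> set B"
    using alternate_center[OF \<open>x \<in> S\<close>] assms(1)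
    unfolding alternate_def separates_iff_append by blast
  then have "count_list B x \<noteq> 0" by (simp add: count_list_0_iff)
  moreover have "count_list B x \<le> 1"
    using count_le_1[of "A @ [c]" B "c # C"] assms by simp
  ultimately show ?thesis by simp
qed

lemma card_rare: "card {x \<in> S. count_list w x \<le> 1} \<le> 1"
  by (rule card_le_1_if_alternate) (use not_alternate_leaves in auto)

lemma card_above_one_center:
  assumes w: "w = A @ c # B" and "c \<notin> set A" "c \<notin> set B"
  shows "card {x \<in> S. c \<prec> x \<and> 1 < count_list w x} \<le> 2"
proof (rule card_le_2_if_above[OF avoids w])
  fix x assume x: "x \<in> {x \<in> S. c \<prec> x \<and> 1 < count_list w x}"
  then have "count_list A x \<le> 1" "count_list B x \<le> 1"
    using count_le_1[of "[]" A "c # B" x] count_le_1[of "A @ [c]" B "[]" x] assms by auto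
  moreover have "1 < count_list A x + count_list B x"
    \<comment> \<open>The middle letter adds nothing to the count of \<open>x\<close>, since
      \<open>c\<close> is not a leaf.\<close>
    using x center_not_leaf by (auto simp: w split: if_splits)
  ultimately show "count_list A x = 1" "count_list B x = 1" by linarith+
qed (use not_alternate_leaves in auto)

text \<open>Cut at the first \<open>c\<close>. The counted leaves missing from \<open>C\<close>
  occur once on each side of the cut, so there are at most two. Leaves above \<open>c\<close> that
  occur in \<open>C\<close> add at most one, and none if some leaf lies below
  \<open>c\<close>.\<close>

lemma card_above_two_centers:
  assumes w: "w = A @ c # B @ c # C" and c: "c \<notin> set A" "c \<notin> set B" "c \<notin> set C"
  shows "card {x \<in> S. c \<prec> x \<and> 1 < count_list w x} \<le> (if \<exists>y\<in>S. y \<prec> c then 2 else 3)"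
proof -
  let ?H = "{x \<in> S. c \<prec> x \<and> 1 < count_list w x}"
  let ?M = "{x \<in> S. c \<prec> x \<and> x \<in> set C}"
  have B: "count_list B x = 1" if "x \<in> S" for x
    using count_eq_1 w c that by blast
  then have inB: "x \<in> set B" if "x \<in> S" for x
    using that by (metis count_notin zero_neq_one)
  have A: "count_list A x \<le> 1" if "x \<in> S" for x
    using count_le_1[of "[]" A "c # B @ c # C" x] w c that by simp
  have "card (?H - ?M) \<le> 2"
  proof (rule card_le_2_if_above[OF avoids w])
    fix x assume x: "x \<in> ?H - ?M"
    then show E: "count_list (B @ c # C) x = 1" using B by auto
    show "count_list A x = 1" using x E A[of x] by (auto simp: w split: if_splits)
  qed (use not_alternate_leaves in auto)
  moreover have "card ?M + 2 \<le> (if \<exists>y\<in>S. y \<prec> c then 2 else 3)"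
  proof (cases "\<exists>y\<in>S. y \<prec> c")
    case True
    then obtain y where y: "y \<in> S" "y \<prec> c" by blast
    have "?M = {}"
    proof (rule ccontr)
      assume "?M \<noteq> {}"
      then obtain x where x: "c \<prec> x" "x \<in> set C" by blast
      \<comment> \<open>The 123 takes \<open>y\<close> from the middle block, the second
        \<open>c\<close>, and \<open>x\<close> from the last block; empty lists stand for skipped
        factors.\<close>
      have "subseq ([] @ [] @ [y] @ [c] @ [x]) (A @ [c] @ B @ [c] @ C)"
        using inB y x by (intro list_emb_append_mono) (simp_all add: subseq_singleton_left)
      then show False using avoids[OF y(2) x(1)] by (simp add: w)
    qed
    then show ?thesis using True by simp
  next
    case False
    have "x = y" if "x \<in> ?M" "y \<in> ?M" for x y
    proof -
      have "\<not> a \<prec> b" if "a \<in> ?M" "b \<in> ?M" for a b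
      proof
        assume "a \<prec> b"
        \<comment> \<open>Now the 123 starts at the first \<open>c\<close> and skips the
          second.\<close>
        have "subseq ([] @ [c] @ [a] @ [] @ [b]) (A @ [c] @ B @ [c] @ C)"
          using inB that by (intro list_emb_append_mono) (simp_all add: subseq_singleton_left)
        then show False using avoids[of c a b] that \<open>a \<prec> b\<close> by (simp add: w)
      qed
      then show ?thesis using that by (meson neqE)
    qed
    then have "card ?M \<le> Suc 0" using finite_leaves by (subst card_le_Suc0_iff_eq) auto
    then show ?thesis using False by simp
  qed
  moreover have "card ?H \<le> card (?H - ?M) + card ?M"
    using finite_leaves card_mono[of "(?H - ?M) \<union> ?M" ?H] card_Un_le[of "?H - ?M" ?M] by auto
  ultimately show ?thesis by linarith
qed

text \<open>Every leaf occurs in both inner blocks, so for leaves \<open>a\<close>, \<open>b\<close>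
  above \<open>c\<close> with \<open>a\<close> below \<open>b\<close>, the first \<open>c\<close>,
  \<open>a\<close> from \<open>B\<close> and \<open>b\<close> from \<open>C\<close> form a
  123.\<close>

lemma card_above_three_centers:
  assumes w: "w = A @ c # B @ c # C @ c # D" and c: "c \<notin> set B" "c \<notin> set C"
  shows "card {x \<in> S. c \<prec> x} \<le> 1"
proof -
  let ?H = "{x \<in> S. c \<prec> x}"
  have "count_list B x = 1" "count_list C x = 1" if "x \<in> S" for x
    using count_eq_1[of A B "C @ c # D" x] count_eq_1[of "A @ c # B" C D x] w c that by auto
  then have inBC: "x \<in> set B" "x \<in> set C" if "x \<in> S" for x
    using that by (metis count_notin zero_neq_one)+
  have "\<not> a \<prec> b" if "a \<in> ?H" "b \<in> ?H" for a b
  proof -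
    have "subseq ([] @ [c] @ [a] @ [] @ [b] @ []) (A @ [c] @ B @ [c] @ C @ (c # D))"
      using that inBC
      by (intro list_emb_append_mono) (simp_all add: subseq_singleton_left)
    then show ?thesis using avoids[of c a b] that by (auto simp: w)
  qed
  then have "x = y" if "x \<in> ?H" "y \<in> ?H" for x y using that by (meson neqE)
  then show ?thesis
    using finite_leaves card_le_Suc0_iff_eq[of ?H] by auto
qed

text \<open>A triple decreasing in \<open>rev w\<close> is increasing in \<open>w\<close>, and
  alternation is invariant under reversal.\<close>

lemma star_word_rev: "star_word (\<lambda>x y. y \<preceq> x) (\<lambda>x y. y \<prec> x) (rev w) c S"
proof -
  have "\<not> subseq [x, y, z] (rev w)" if "y \<prec> x" "z \<prec> y" for x y z
    using avoids[OF that(2,1)] subseq_rev[of "[x, y, z]" "rev w"] by auto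
  moreover have "alternate c x (rev w)" if "x \<in> S" for x
    using alternate_center[OF that] center_not_leaf that alternate_rev[of c x w] by auto
  ultimately show ?thesis
    using dual_linorder finite_leaves center_not_leaf not_alternate_leaves
    by (intro star_word.intro star_word_axioms.intro) (auto simp: alternate_rev)
qed

lemma card_leaves_le_5: "card S \<le> 5"
proof -
  interpret dual: star_word "\<lambda>x y. y \<preceq> x" "\<lambda>x y. y \<prec> x" "rev w" c S
    by (rule star_word_rev)
  let ?R = "{x \<in> S. count_list w x \<le> 1}"
  let ?H = "{x \<in> S. c \<prec> x \<and> 1 < count_list w x}"
  let ?L = "{x \<in> S. x \<prec> c \<and> 1 < count_list w x}"
  have "x \<prec> c \<or> c \<prec> x" if "x \<in> S" for x
    using that center_not_leaf by (metis neqE)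
  \<comment> \<open>The first decomposition sets the rare leaves apart and serves one or two
    centres; the second serves three or more, where the bounds cover all leaves.\<close>
  then have S: "S = ?R \<union> ?H \<union> ?L" "S = {x \<in> S. c \<prec> x} \<union> {x \<in> S. x \<prec> c}"
    by force+
  have card_S: "card S \<le> 1 + card ?H + card ?L"
    using card_rare card_Un_le[of "?R \<union> ?H" ?L] card_Un_le[of ?R ?H] arg_cong[OF S(1), of card]
    by linarith
  consider "count_list w c = 0" | "count_list w c = Suc 0" | "count_list w c = Suc (Suc 0)"
    | n where "count_list w c = Suc (Suc (Suc n))"
    by (metis not0_implies_Suc)
  then show ?thesis
  proof cases
    case 1
    then have "?R = S" using count_le_1[of "[]" w "[]"] by (auto simp: count_list_0_iff)
    then show ?thesis using card_rare by simp
  next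
    case 2
    then obtain A B where w: "w = A @ c # B" "c \<notin> set A" "c \<notin> set B"
      by (metis count_list_Suc_split_first count_list_0_iff)
    then have "rev w = rev B @ c # rev A" by simp
    note dual.card_above_one_center[OF this, unfolded count_list_rev set_rev]
      card_above_one_center[OF w]
    then have "card ?H \<le> 2" "card ?L \<le> 2" using w(2-) by blast+
    then show ?thesis using card_S by linarith
  next
    case 3
    then obtain A B C where w: "w = A @ c # B @ c # C" "c \<notin> set A" "c \<notin> set B" "c \<notin> set C"
      by (metis count_list_Suc_split_first count_list_0_iff)
    then have "rev w = rev C @ c # rev B @ c # rev A" by simp
    note dual.card_above_two_centers[OF this, unfolded count_list_rev set_rev]
      card_above_two_centers[OF w]
    then have "card ?H \<le> (if \<exists>y\<in>S. y \<prec> c then 2 else 3)"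
      "card ?L \<le> (if \<exists>y\<in>S. c \<prec> y then 2 else 3)" using w(2-) by blast+
    \<comment> \<open>If one side of \<open>c\<close> has no leaves, the other may have the weaker
      bound 3, but the total is then at most 1 + 3.\<close>
    moreover have "card ?H = 0" if "\<not> (\<exists>y\<in>S. c \<prec> y)"
    proof -
      have "?H = {}" using that by blast
      then show ?thesis by (simp only: card.empty)
    qed
    moreover have "card ?L = 0" if "\<not> (\<exists>y\<in>S. y \<prec> c)"
    proof -
      have "?L = {}" using that by blast
      then show ?thesis by (simp only: card.empty)
    qed
    ultimately show ?thesis using card_S by (auto split: if_splits)
  next
    case (4 n)
    then obtain A B C D where w: "w = A @ c # B @ c # C @ c # D" "c \<notin> set B" "c \<notin> set C"
      by (metis count_list_Suc_split_first)
    then have "rev w = rev D @ c # rev C @ c # rev B @ c # rev A" by simp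
    note dual.card_above_three_centers[OF this, unfolded set_rev] card_above_three_centers[OF w]
    then have "card {x \<in> S. c \<prec> x} \<le> 1" "card {x \<in> S. x \<prec> c} \<le> 1"
      using w(2-) by blast+
    then show ?thesis
      using arg_cong[OF S(2), of card] card_Un_le[of "{x \<in> S. c \<prec> x}" "{x \<in> S. x \<prec> c}"]
      by linarith
  qed
qed

end

section \<open>From the labelled graph to a star word\<close>

theorem theorem3p7:
  fixes G :: "('a, 'b) pre_digraph"
  assumes "K\<^bsub>1,6\<^esub> G"
  shows "\<not> representable_123 TYPE('l::linorder) G"
proof
  assume "representable_123 TYPE('l) G"
  then obtain label :: "'a \<Rightarrow> 'l" and w where inj: "inj_on label (verts G)"
    and rep: "represents w G" and av: "\<not> contains_123 (map label w)"
    by (auto simp: representable_123_def)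
  obtain U V where verts: "verts G = U \<union> V" "U \<inter> V = {}" "card U = 1" "card V = 6"
    and arcs: "arcs_ends G = U \<times> V \<union> V \<times> U"
    using assms by (auto simp: complete_bipartite_digraph_def)
  obtain u where U: "U = {u}" using verts(3) card_1_singletonE by blast
  \<comment> \<open>The order lives on labels and adjacency on vertices, so alternation is moved to
    the labelled word.\<close>
  have alt: "alternate (label x) (label y) (map label w) \<longleftrightarrow> x \<rightarrow>\<^bsub>G\<^esub> y"
    if "x \<in> verts G" "y \<in> verts G" "x \<noteq> y" for x y
  proof -
    have "insert x (insert y (set w)) \<subseteq> verts G" using rep that by (auto simp: represents_def)
    then have "inj_on label (insert x (insert y (set w)))" using inj inj_on_subset by blast
    then show ?thesis using rep that by (simp add: alternate_map represents_def)
  qed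
  interpret star_word "(\<le>)" "(<)" "map label w" "label u" "label ` V"
  proof
    show "finite (label ` V)" using verts(4) by (metis card.infinite finite_imageI zero_neq_numeral)
    show "label u \<notin> label ` V" using inj verts U by (auto simp: inj_on_def)
    show "\<not> subseq [x, y, z] (map label w)" if "x < y" "y < z" for x y z
    proof
      assume "subseq [x, y, z] (map label w)"
      moreover have "sorted_wrt (<) [x, y, z]" using that by auto
      ultimately show False using av unfolding contains_123_def
        by (metis list.size(3,4) add_Suc_right add_0_right numeral_3_eq_3)
    qed
    show "alternate (label u) x (map label w)" if "x \<in> label ` V" for x
      using that alt verts U arcs by auto
    show "\<not> alternate x y (map label w)" if "x \<in> label ` V" "y \<in> label ` V" "x \<noteq> y" for x y
      using that alt verts U arcs by auto
  qed
  have "card (label ` V) = 6"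
    using inj verts by (metis card_image inj_on_Un)
  then show False using card_leaves_le_5 by simp
qed

end
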